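(* Assume Conjecture A (stated in the context). Then there is an algorithm which takes as input a Diophantine equation $D(x_1,\ldots,x_p)=0$ with $D\in\mathbb{Z}[x_1,\ldots,x_p]$ and returns an integer $b$ with the following property: if the equation $D(x_1,\ldots,x_p)=0$ has only finitely many solutions in non-negative integers, then every solution $(x_1,\ldots,x_p)\in\mathbb{N}^p$ satisfies $x_1,\ldots,x_p\leqslant b$.
   Context: $\mathbb{N}=\{0,1,2,\ldots\}$. For a positive integer $n$, let $G_n=\{x_i\cdot x_j=x_k : i,j,k\in\{1,\ldots,n\}\}\cup\{x_i+1=x_k : i,k\in\{1,\ldots,n\}\}$, a set of equations in the variables $x_1,\ldots,x_n$. Define $f(1)=1$ and $f(n+1)=2^{2^{f(n)}}$ for every positive integer $n$. Conjecture A: for every positive integer $n$, if a system $\mathcal{S}\subseteq G_n$ has only finitely many solutions in non-negative integers $x_1,\ldots,x_n$, then each such solution $(x_1,\ldots,x_n)$ satisfies $x_1,\ldots,x_n\leqslant f(2n)$. A Diophantine equation is an equation $D(x_1,\ldots,x_p)=0$ with $p\geqslant 1$ and $D\in\mathbb{Z}[x_1,\ldots,x_p]$; the list of variables $x_1,\ldots,x_p$ is part of the data. *)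

theory Defs
  imports
    "HOL-Library.FuncSet"
    "HOL-Library.Nat_Bijection"
    "HOL-Library.Poly_Mapping"
begin

section \<open>Partial recursive functions\<close>

datatype recf =
    RZero
  | RSucc
  | RProj nat
  | RComp recf "recf list"
  | RPrec recf recf
  | RMu recf

text \<open>
  \<open>rec_eval r xs y\<close>: the computation of \<open>r\<close> on the arguments \<open>xs\<close> terminates with result \<open>y\<close>.
  Arities are not recorded in the syntax: a term applied to an argument list of an unsuitable
  length has no value, and for each \<open>k\<close> a term denotes one \<open>k\<close>-ary partial recursive function.
  The recursion variable, and the variable bound by minimisation, is the first argument.
\<close>

inductive rec_eval :: "recf \<Rightarrow> nat list \<Rightarrow> nat \<Rightarrow> bool" where
  zero: "rec_eval RZero xs 0"
| succ: "rec_eval RSucc [x] (Suc x)"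
| proj: "i < length xs \<Longrightarrow> rec_eval (RProj i) xs (xs ! i)"
| comp: "length ys = length gs \<Longrightarrow> (\<forall>i < length gs. rec_eval (gs ! i) xs (ys ! i)) \<Longrightarrow>
         rec_eval f ys z \<Longrightarrow> rec_eval (RComp f gs) xs z"
| prec_0: "rec_eval f xs y \<Longrightarrow> rec_eval (RPrec f g) (0 # xs) y"
| prec_Suc: "rec_eval (RPrec f g) (n # xs) y \<Longrightarrow> rec_eval g (n # y # xs) z \<Longrightarrow>
         rec_eval (RPrec f g) (Suc n # xs) z"
| mu: "rec_eval f (n # xs) 0 \<Longrightarrow> (\<forall>m < n. \<exists>y > 0. rec_eval f (m # xs) y) \<Longrightarrow>
         rec_eval (RMu f) xs n"

lemma rec_eval_deterministic:
  assumes "rec_eval r xs y" "rec_eval r xs y'"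
  shows "y = y'"
  using assms
proof (induction arbitrary: y' rule: rec_eval.induct)
  case (zero xs)
  then show ?case by cases auto
next
  case (succ x)
  then show ?case by cases auto
next
  case (proj i xs)
  from proj(2) show ?case by (cases rule: rec_eval.cases) auto
next
  case (comp ys gs xs f z)
  from comp.prems obtain ys' where ys': "length ys' = length gs"
    "\<forall>i < length gs. rec_eval (gs ! i) xs (ys' ! i)" "rec_eval f ys' y'"
    by (cases rule: rec_eval.cases) auto
  have "ys = ys'"
    using comp.hyps(1) comp.IH(1) ys'(1,2) by (auto intro!: nth_equalityI)
  with comp.IH(2) ys'(3) show ?case by blast
next
  case (prec_0 f xs y g)
  from prec_0.prems have "rec_eval f xs y'" by (cases rule: rec_eval.cases) auto
  with prec_0.IH show ?case by blast
next
  case (prec_Suc f g n xs y z)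
  from prec_Suc.prems obtain u where "rec_eval (RPrec f g) (n # xs) u" "rec_eval g (n # u # xs) y'"
    by (cases rule: rec_eval.cases) auto
  with prec_Suc.IH show ?case by blast
next
  case (mu f n xs)
  from mu.prems have y': "rec_eval f (y' # xs) 0 \<and> (\<forall>m < y'. \<exists>y > 0. rec_eval f (m # xs) y)"
    by (cases rule: rec_eval.cases) auto
  have "\<not> n < y'" using mu.IH(1) y' by blast
  moreover have "\<not> y' < n" using mu.IH(2) y' by blast
  ultimately show ?case by simp
qed


section \<open>Diophantine equations\<close>

text \<open>
  A polynomial is a finitely supported map from monomials to integer coefficients, a monomial
  a finitely supported map from variable indices to exponents.
\<close>

type_synonym int_mpoly = "(nat \<Rightarrow>\<^sub>0 nat) \<Rightarrow>\<^sub>0 int"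

definition int_mpolys :: "nat \<Rightarrow> int_mpoly set" where
  "int_mpolys p = {D. \<forall>m \<in> Poly_Mapping.keys D. Poly_Mapping.keys m \<subseteq> {1..p}}"

definition mpoly_eval :: "int_mpoly \<Rightarrow> (nat \<Rightarrow> int) \<Rightarrow> int" where
  "mpoly_eval D x =
     (\<Sum>m \<in> Poly_Mapping.keys D. Poly_Mapping.lookup D m *
        (\<Prod>i \<in> Poly_Mapping.keys m. x i ^ Poly_Mapping.lookup m i))"

definition dioph_solutions :: "nat \<Rightarrow> int_mpoly \<Rightarrow> (nat \<Rightarrow> nat) set" where
  "dioph_solutions p D = {x \<in> {1..p} \<rightarrow>\<^sub>E UNIV. mpoly_eval D (\<lambda>i. int (x i)) = 0}"

text \<open>
  Goedel number of the equation \<open>D(x\<^sub>1,\<dots>,x\<^sub>p) = 0\<close>: the number \<open>p\<close> of variables together with the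
  finite set of all pairs (exponent vector of length \<open>p\<close>, nonzero coefficient) of \<open>D\<close>.
\<close>

definition dioph_code :: "nat \<Rightarrow> int_mpoly \<Rightarrow> nat" where
  "dioph_code p D =
     prod_encode (p, set_encode
       ((\<lambda>m. prod_encode (list_encode (map (Poly_Mapping.lookup m) [1..<Suc p]),
                          int_encode (Poly_Mapping.lookup D m))) ` Poly_Mapping.keys D))"

lemma exponent_vector_inj:
  fixes m m' :: "nat \<Rightarrow>\<^sub>0 nat"
  assumes eq: "map (Poly_Mapping.lookup m) [1..<Suc p] = map (Poly_Mapping.lookup m') [1..<Suc p]"
    and m: "Poly_Mapping.keys m \<subseteq> {1..p}" and m': "Poly_Mapping.keys m' \<subseteq> {1..p}"
  shows "m = m'"
proof (rule poly_mapping_eqI)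
  fix k
  have "\<forall>k \<in> set [1..<Suc p]. Poly_Mapping.lookup m k = Poly_Mapping.lookup m' k"
    using eq unfolding map_eq_conv .
  then have *: "k \<in> {1..p} \<Longrightarrow> Poly_Mapping.lookup m k = Poly_Mapping.lookup m' k"
    unfolding set_upt atLeastLessThanSuc_atLeastAtMost by blast
  show "Poly_Mapping.lookup m k = Poly_Mapping.lookup m' k"
  proof (cases "k \<in> {1..p}")
    case True
    then show ?thesis by (rule *)
  next
    case False
    then have "k \<notin> Poly_Mapping.keys m" "k \<notin> Poly_Mapping.keys m'" using m m' by blast+
    then show ?thesis unfolding in_keys_iff by simp
  qed
qed

lemma coded_terms_eqD:
  assumes eq: "(\<lambda>m. prod_encode (list_encode (map (Poly_Mapping.lookup m) [1..<Suc p]),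
                  int_encode (Poly_Mapping.lookup D m))) ` Poly_Mapping.keys D =
           (\<lambda>m. prod_encode (list_encode (map (Poly_Mapping.lookup m) [1..<Suc p]),
                  int_encode (Poly_Mapping.lookup D' m))) ` Poly_Mapping.keys D'"
      (is "?g ` _ = ?g' ` _")
    and D: "D \<in> int_mpolys p" and D': "D' \<in> int_mpolys p" and m: "m \<in> Poly_Mapping.keys D"
  shows "Poly_Mapping.lookup D m = Poly_Mapping.lookup D' m"
proof -
  have "?g m \<in> ?g' ` Poly_Mapping.keys D'" using imageI[OF m, of ?g] unfolding eq .
  then obtain m' where m': "m' \<in> Poly_Mapping.keys D'" "?g m = ?g' m'" by (rule imageE)
  from m'(2) have vl: "map (Poly_Mapping.lookup m) [1..<Suc p] = map (Poly_Mapping.lookup m') [1..<Suc p]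
      \<and> Poly_Mapping.lookup D m = Poly_Mapping.lookup D' m'"
    unfolding prod_encode_eq prod.inject list_encode_eq int_encode_eq .
  have "Poly_Mapping.keys m \<subseteq> {1..p}" "Poly_Mapping.keys m' \<subseteq> {1..p}"
    using D D' m m'(1) unfolding int_mpolys_def by blast+
  with vl have "m = m'" by (intro exponent_vector_inj) (rule conjunct1)
  with vl show ?thesis by (simp only:)
qed

lemma dioph_code_inj:
  assumes D: "D \<in> int_mpolys p" and D': "D' \<in> int_mpolys p'"
    and eq: "dioph_code p D = dioph_code p' D'"
  shows "p = p' \<and> D = D'"
proof -
  have p: "p' = p" using eq unfolding dioph_code_def prod_encode_eq prod.inject by blast
  note images = eq[unfolded dioph_code_def p prod_encode_eq prod.inject, THEN conjunct2,
      unfolded set_encode_eq[OF finite_imageI[OF finite_keys] finite_imageI[OF finite_keys]]]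
  note D'_p = D'[unfolded p]
  have "D = D'"
  proof (rule poly_mapping_eqI)
    fix m
    consider "m \<in> Poly_Mapping.keys D" | "m \<in> Poly_Mapping.keys D'"
      | "m \<notin> Poly_Mapping.keys D" "m \<notin> Poly_Mapping.keys D'" by blast
    then show "Poly_Mapping.lookup D m = Poly_Mapping.lookup D' m"
    proof cases
      case 1
      then show ?thesis by (rule coded_terms_eqD[OF images D D'_p])
    next
      case 2
      then show ?thesis by (rule coded_terms_eqD[OF images[symmetric] D'_p D, symmetric])
    next
      case 3
      then show ?thesis unfolding in_keys_iff by simp
    qed
  qed
  with p show ?thesis by simp
qed


section \<open>Systems of equations and the conjecture on their solutions\<close>

text \<open>\<open>MultEq i j k\<close> stands for \<open>x\<^sub>i \<sqdot> x\<^sub>j = x\<^sub>k\<close> and \<open>SuccEq i k\<close> for \<open>x\<^sub>i + 1 = x\<^sub>k\<close>.\<close>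

datatype equation = MultEq nat nat nat | SuccEq nat nat

definition G :: "nat \<Rightarrow> equation set" where
  "G n = {MultEq i j k | i j k. i \<in> {1..n} \<and> j \<in> {1..n} \<and> k \<in> {1..n}} \<union>
         {SuccEq i k | i k. i \<in> {1..n} \<and> k \<in> {1..n}}"

fun satisfies :: "(nat \<Rightarrow> nat) \<Rightarrow> equation \<Rightarrow> bool" where
  "satisfies x (MultEq i j k) \<longleftrightarrow> x i * x j = x k"
| "satisfies x (SuccEq i k) \<longleftrightarrow> x i + 1 = x k"

definition system_solutions :: "nat \<Rightarrow> equation set \<Rightarrow> (nat \<Rightarrow> nat) set" where
  "system_solutions n S = {x \<in> {1..n} \<rightarrow>\<^sub>E UNIV. \<forall>e \<in> S. satisfies x e}"

text \<open>Only the values at positive arguments matter; the value at \<open>0\<close> is a dummy.\<close>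

fun bound_f :: "nat \<Rightarrow> nat" where
  "bound_f 0 = 0"
| "bound_f (Suc 0) = 1"
| "bound_f (Suc (Suc n)) = 2 ^ (2 ^ bound_f (Suc n))"

definition conjecture_A :: bool where
  "conjecture_A \<longleftrightarrow>
     (\<forall>n \<ge> 1. \<forall>S \<subseteq> G n. finite (system_solutions n S) \<longrightarrow>
        (\<forall>x \<in> system_solutions n S. \<forall>i \<in> {1..n}. x i \<le> bound_f (2 * n)))"

end

theory Submission
  imports Defs
begin

text \<open>
  Conjecture A bounds the solutions of a system by a function of the number \<open>n\<close> of its variables
  alone, so it suffices to turn the equation \<open>D = 0\<close> into a system with corresponding solutions
  whose size is bounded computably in the code \<open>c\<close> of the equation. No system has to be
  computed: the algorithm ignores everything about the equation except the number \<open>c\<close>, and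
  returns \<open>bound_f\<close> at a point that is at least \<open>2 * n\<close>.

  For the translation, write \<open>D = P - N\<close> with natural coefficients and build \<open>P\<close> and \<open>N\<close> from the
  variables by multiplications and additions, giving each intermediate value a variable of its
  own. Addition is not among the permitted equations, but it is definable from products and
  successors by Julia Robinson's identity (\<open>sum_iff_products\<close>, \<open>definable_add\<close>). Every new variable
  is forced to equal a fixed function of \<open>x\<^sub>1,\<dots>,x\<^sub>p\<close>. Hence restriction to the first \<open>p\<close> coordinates
  is a bijection from the solutions of the system to those of the equation (\<open>dioph_system\<close>); in
  particular one solution set is finite iff the other one is.

  The number of variables is polynomial in \<open>p\<close>, the number of monomials, the exponents and the
  coefficients, all of which are at most \<open>c\<close> (\<open>dioph_code_bounds\<close>). A bound of the form
  \<open>2 ^ (4 * (c + 2))\<close> for twice this number (\<open>size_le_power\<close>) keeps the computability argument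
  within unary functions obtained by composition and iteration.
\<close>

section \<open>Unary total recursive functions\<close>

definition recursive :: "(nat \<Rightarrow> nat) \<Rightarrow> bool" where
  "recursive h \<longleftrightarrow> (\<exists>r. \<forall>x. rec_eval r [x] (h x))"

lemma recursive_Suc: "recursive Suc"
  unfolding recursive_def using rec_eval.succ by blast

lemma rec_eval_comp1:
  assumes "rec_eval g xs y" "rec_eval f [y] z"
  shows "rec_eval (RComp f [g]) xs z"
  using rec_eval.comp[of "[y]" "[g]" xs f z] assms by simp

lemma recursive_comp:
  assumes "recursive f" "recursive g"
  shows "recursive (\<lambda>x. f (g x))"
  using assms rec_eval_comp1 unfolding recursive_def by meson

lemma rec_eval_const: "\<exists>r. \<forall>xs. rec_eval r xs c"
proof (induction c)
  case 0
  then show ?case using rec_eval.zero by blast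
next
  case (Suc c)
  then show ?case using rec_eval_comp1 rec_eval.succ by blast
qed

text \<open>
  Iteration from a constant is primitive recursion without parameters. Doubling, powers of two and
  \<open>bound_f\<close> arise from the successor by iterating and composing, so that no function of two
  arguments has to be programmed.
\<close>

lemma recursive_funpow:
  assumes "recursive g"
  shows "recursive (\<lambda>n. (g ^^ n) c)"
proof -
  obtain rg where rg: "\<And>x. rec_eval rg [x] (g x)"
    using assms unfolding recursive_def by blast
  obtain rc where rc: "\<And>xs. rec_eval rc xs c"
    using rec_eval_const by blast
  have "rec_eval (RPrec rc (RComp rg [RProj 1])) [n] ((g ^^ n) c)" for n
  proof (induction n)
    case 0
    then show ?case using rc by (simp add: rec_eval.prec_0)
  next
    case (Suc n)
    \<comment> \<open>The step term receives the counter and the previous value; only the latter is projected out.\<close>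
    have "rec_eval (RProj 1) [n, (g ^^ n) c] ((g ^^ n) c)"
      using rec_eval.proj[of 1 "[n, (g ^^ n) c]"] by simp
    then have "rec_eval (RComp rg [RProj 1]) [n, (g ^^ n) c] (g ((g ^^ n) c))"
      using rg by (rule rec_eval_comp1)
    with Suc show ?case by (simp add: rec_eval.prec_Suc)
  qed
  then show ?thesis unfolding recursive_def by blast
qed

lemma recursive_double: "recursive (\<lambda>n. 2 * n)"
proof -
  have "((\<lambda>x. Suc (Suc x)) ^^ n) 0 = 2 * n" for n by (induction n) auto
  then show ?thesis
    using recursive_funpow[OF recursive_comp[OF recursive_Suc recursive_Suc], of 0] by simp
qed

lemma recursive_power2: "recursive (\<lambda>n. 2 ^ n)"
proof -
  have "((\<lambda>x. 2 * x) ^^ n) 1 = (2::nat) ^ n" for n by (induction n) auto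
  then show ?thesis using recursive_funpow[OF recursive_double, of 1] by simp
qed

lemma recursive_bound_f: "recursive (\<lambda>n. bound_f (Suc n))"
proof -
  have "((\<lambda>x. 2 ^ (2 ^ x)) ^^ n) 1 = bound_f (Suc n)" for n by (induction n) auto
  then show ?thesis
    using recursive_funpow[OF recursive_comp[OF recursive_power2 recursive_power2], of 1] by simp
qed

lemma bound_f_mono: "m \<le> n \<Longrightarrow> bound_f m \<le> bound_f n"
proof (rule lift_Suc_mono_le[of bound_f])
  have less: "x < 2 ^ (2 ^ x)" for x :: nat
    by (rule less_trans) (rule less_exp)+
  show "bound_f n \<le> bound_f (Suc n)" for n
    using less[of "bound_f n"] by (cases n rule: bound_f.cases) auto
qed


section \<open>Systems that define functions of their first variables\<close>

definition determined :: "nat \<Rightarrow> ((nat \<Rightarrow> nat) \<Rightarrow> nat) \<Rightarrow> bool" where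
  "determined p h \<longleftrightarrow> (\<forall>x y. (\<forall>j\<in>{1..p}. x j = y j) \<longrightarrow> h x = h y)"

text \<open>
  The system \<open>S\<close> is equivalent to \<open>y\<^sub>i = F i y\<close> for all \<open>i\<close>. As each \<open>F i\<close> depends only on the first
  \<open>p\<close> coordinates, and these are free, every choice of \<open>x\<^sub>1,\<dots>,x\<^sub>p\<close> extends to exactly one solution.
  Assignments here are total functions, with arbitrary values outside \<open>{1..n}\<close>.
\<close>

definition forces :: "nat \<Rightarrow> nat \<Rightarrow> (nat \<Rightarrow> (nat \<Rightarrow> nat) \<Rightarrow> nat) \<Rightarrow> equation set \<Rightarrow> bool" where
  "forces p n F S \<longleftrightarrow> S \<subseteq> G n \<and> p \<le> n \<and> (\<forall>i\<in>{1..p}. F i = (\<lambda>x. x i)) \<and>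
     (\<forall>i\<in>{1..n}. determined p (F i)) \<and>
     (\<forall>y. (\<forall>e\<in>S. satisfies y e) \<longleftrightarrow> (\<forall>i\<in>{1..n}. y i = F i y))"

text \<open>
  The functions in \<open>A\<close> occur simultaneously as coordinates of one system. Both \<open>n\<close> and \<open>A\<close> are
  allowed slack, as upper bound and as subset, so that intermediate values can be forgotten and
  sizes estimated along the way.
\<close>

definition definable :: "nat \<Rightarrow> nat \<Rightarrow> ((nat \<Rightarrow> nat) \<Rightarrow> nat) set \<Rightarrow> bool" where
  "definable p n A \<longleftrightarrow> (\<exists>m F S. m \<le> n \<and> forces p m F S \<and> A \<subseteq> F ` {1..m})"

lemma G_mono: "m \<le> n \<Longrightarrow> G m \<subseteq> G n"
  unfolding G_def by fastforce

lemma definable_mono: "definable p n A \<Longrightarrow> n \<le> n' \<Longrightarrow> B \<subseteq> A \<Longrightarrow> definable p n' B"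
  unfolding definable_def by (meson order_trans)

lemma definable_determined: "definable p n A \<Longrightarrow> f \<in> A \<Longrightarrow> determined p f"
  unfolding definable_def forces_def by blast

lemma definable_projections: "definable p p ((\<lambda>i x. x i) ` {1..p})"
proof -
  have "forces p p (\<lambda>i x. x i) {}"
    unfolding forces_def determined_def by auto
  then show ?thesis unfolding definable_def by blast
qed

text \<open>
  Append the functions \<open>hs\<close> as new coordinates, by equations \<open>E\<close> between them and the coordinates
  \<open>i\<close>, \<open>j\<close> that carry two known functions \<open>f\<close>, \<open>g\<close>. Where these sit, and where the free indices
  start, depends on the given system, hence the quantification over \<open>m\<close>, \<open>i\<close>, \<open>j\<close>. The new equations
  need only force the values \<open>hs\<close> jointly; in the application to addition, no single one of them
  determines the sum.
\<close>

lemma definable_extend: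
  assumes A: "definable p n A" and fg: "f \<in> A" "g \<in> A"
    and hs: "\<forall>h\<in>set hs. determined p h"
    and E: "\<And>m i j. i \<in> {1..m} \<Longrightarrow> j \<in> {1..m} \<Longrightarrow>
      \<exists>E \<subseteq> G (m + length hs). \<forall>y. y i = f y \<longrightarrow> y j = g y \<longrightarrow>
        (\<forall>e\<in>E. satisfies y e) = (\<forall>t < length hs. y (m + Suc t) = (hs ! t) y)"
  shows "definable p (n + length hs) (set hs \<union> A)"
proof -
  obtain m F S where m: "m \<le> n" "A \<subseteq> F ` {1..m}" and F: "S \<subseteq> G m" "p \<le> m"
      "\<forall>i\<in>{1..p}. F i = (\<lambda>x. x i)" "\<forall>i\<in>{1..m}. determined p (F i)"
      "\<forall>y. (\<forall>e\<in>S. satisfies y e) \<longleftrightarrow> (\<forall>i\<in>{1..m}. y i = F i y)"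
    using A unfolding definable_def forces_def by blast
  obtain i j where ij: "i \<in> {1..m}" "j \<in> {1..m}" "F i = f" "F j = g"
    using fg m(2) by blast
  obtain E where E: "E \<subseteq> G (m + length hs)" "\<And>y. y i = f y \<Longrightarrow> y j = g y \<Longrightarrow>
      (\<forall>e\<in>E. satisfies y e) = (\<forall>t < length hs. y (m + Suc t) = (hs ! t) y)"
    using E[OF ij(1,2)] by blast
  define F' where "F' k = (if k \<le> m then F k else hs ! (k - Suc m))" for k
  have F'_old: "F' k = F k" if "k \<in> {1..m}" for k using that by (simp add: F'_def)
  have F'_new: "F' (m + Suc t) = hs ! t" for t by (simp add: F'_def)
  have split: "{1..m + length hs} = {1..m} \<union> (\<lambda>t. m + Suc t) ` {..<length hs}"
  proof -
    have "k \<in> (\<lambda>t. m + Suc t) ` {..<length hs}" if "m < k" "k \<le> m + length hs" for k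
      using that by (intro image_eqI[of _ _ "k - Suc m"]) auto
    then have "k \<in> {1..m} \<union> (\<lambda>t. m + Suc t) ` {..<length hs}" if "k \<in> {1..m + length hs}" for k
      using that by (cases "k \<le> m") (simp_all del: add_Suc_right)
    moreover have "{1..m} \<union> (\<lambda>t. m + Suc t) ` {..<length hs} \<subseteq> {1..m + length hs}"
      by auto
    ultimately show ?thesis by blast
  qed
  have "forces p (m + length hs) F' (S \<union> E)"
    unfolding forces_def
  proof (intro conjI allI)
    show "S \<union> E \<subseteq> G (m + length hs)" using F(1) E(1) G_mono[of m "m + length hs"] by auto
    show "p \<le> m + length hs" using F(2) by simp
    show "\<forall>i\<in>{1..p}. F' i = (\<lambda>x. x i)" using F(2,3) by (simp add: F'_def)
    show "\<forall>i\<in>{1..m + length hs}. determined p (F' i)"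
      unfolding split ball_Un using F(4) hs by (simp add: F'_old F'_new[simplified])
    show "(\<forall>e\<in>S \<union> E. satisfies y e) \<longleftrightarrow> (\<forall>i\<in>{1..m + length hs}. y i = F' i y)" for y
    proof -
      have "(\<forall>i\<in>{1..m + length hs}. y i = F' i y) \<longleftrightarrow> (\<forall>i\<in>{1..m}. y i = F i y) \<and>
          (\<forall>t < length hs. y (m + Suc t) = (hs ! t) y)"
        unfolding split ball_Un ball_simps(9) F'_new using F'_old by (simp add: lessThan_iff Ball_def del: add_Suc_right)
      moreover have "(\<forall>i\<in>{1..m}. y i = F i y) \<Longrightarrow> y i = f y \<and> y j = g y"
        using ij by blast
      ultimately show ?thesis using F(5) E(2) unfolding ball_Un by blast
    qed
  qed
  moreover have "set hs \<union> A \<subseteq> F' ` {1..m + length hs}"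
  proof -
    have "set hs \<subseteq> F' ` (\<lambda>t. m + Suc t) ` {..<length hs}"
      unfolding image_image F'_new by (auto simp: in_set_conv_nth)
    moreover have "A \<subseteq> F' ` {1..m}"
      using m(2) image_cong[OF refl F'_old, of "{1..m}" "\<lambda>x. x"] by simp
    ultimately show ?thesis unfolding split by blast
  qed
  ultimately show ?thesis using m(1) unfolding definable_def
    by (intro exI[of _ "m + length hs"] exI[of _ F'] exI[of _ "S \<union> E"]) simp
qed

lemma definable_mult:
  assumes A: "definable p n A" and fg: "f \<in> A" "g \<in> A"
  shows "definable p (Suc n) (insert (\<lambda>x. f x * g x) A)"
proof -
  have det: "determined p (\<lambda>x. f x * g x)"
    using fg[THEN definable_determined[OF A]] unfolding determined_def by metis
  show ?thesis
    using definable_extend[OF A fg, of "[\<lambda>x. f x * g x]"] det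
  proof (simp, elim meta_mp)
    fix m i j :: nat
    assume "Suc 0 \<le> i \<and> i \<le> m" "Suc 0 \<le> j \<and> j \<le> m"
    then show "\<exists>E\<subseteq>G (Suc m). \<forall>y. y i = f y \<longrightarrow> y j = g y \<longrightarrow>
        (\<forall>e\<in>E. satisfies y e) = (y (Suc m) = f y * g y)"
      by (intro exI[of _ "{MultEq i j (Suc m)}"]) (auto simp: G_def)
  qed
qed

text \<open>
  If \<open>u + 1 = v\<close> and \<open>v * v = v\<close>, then \<open>v\<close> is a positive idempotent, so \<open>v = 1\<close> and \<open>u = 0\<close>.
\<close>

lemma definable_zero_one:
  assumes A: "definable p n A" and f: "f \<in> A"
  shows "definable p (n + 2) ({\<lambda>x. 0, \<lambda>x. 1} \<union> A)"
proof -
  have "definable p (n + length [\<lambda>x::nat \<Rightarrow> nat. 0::nat, \<lambda>x. 1]) (set [\<lambda>x. 0, \<lambda>x. 1] \<union> A)"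
  proof (rule definable_extend[OF A f f])
    show "\<forall>h\<in>set [\<lambda>x::nat \<Rightarrow> nat. 0::nat, \<lambda>x. 1]. determined p h"
      by (simp add: determined_def)
    fix m i j :: nat
    have "{SuccEq (m + 1) (m + 2), MultEq (m + 2) (m + 2) (m + 2)} \<subseteq> G (m + 2)"
      by (auto simp: G_def)
    then show "\<exists>E\<subseteq>G (m + length [\<lambda>x::nat \<Rightarrow> nat. 0::nat, \<lambda>x. 1]). \<forall>y. y i = f y \<longrightarrow> y j = f y \<longrightarrow>
        (\<forall>e\<in>E. satisfies y e) = (\<forall>t<length [\<lambda>x::nat \<Rightarrow> nat. 0::nat, \<lambda>x. 1].
          y (m + Suc t) = ([\<lambda>x. 0, \<lambda>x. 1] ! t) y)"
      by (intro exI[of _ "{SuccEq (m + 1) (m + 2), MultEq (m + 2) (m + 2) (m + 2)}"])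
        (auto simp: All_less_Suc)
  qed
  then show ?thesis by (simp add: numeral_2_eq_2)
qed

text \<open>
  Julia Robinson's definition of addition: after expanding, \<open>z * z * x * y + 1\<close> cancels and
  \<open>z * (x + y) = z * z\<close> remains.
\<close>

lemma sum_iff_products:
  fixes x y z :: nat
  assumes "z > 0"
  shows "(z * x + 1) * (z * y + 1) = z * z * (x * y + 1) + 1 \<longleftrightarrow> z = x + y"
proof -
  have "(z * x + 1) * (z * y + 1) = z * z * (x * y + 1) + 1 \<longleftrightarrow> z * (x + y) = z * z"
    by (auto simp: algebra_simps)
  then show ?thesis using assms by auto
qed

text \<open>
  Robinson's identity requires \<open>z > 0\<close>. Applying it to \<open>f + 1\<close>, \<open>g + 1\<close> and \<open>w + 2\<close> ensures this and
  still expresses \<open>w = f + g\<close>. The 14 new variables are \<open>w\<close> and the values of all subterms of the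
  identity, except that the right-hand side has no variable of its own: the last equation identifies
  it with the left-hand side.
\<close>

lemma definable_add:
  assumes A: "definable p n A" and fg: "f \<in> A" "g \<in> A"
  shows "definable p (n + 14) (insert (\<lambda>x. f x + g x) A)"
proof -
  let ?z = "\<lambda>x. f x + g x + 2"
  let ?f = "\<lambda>x. f x + 1"
  let ?g = "\<lambda>x. g x + 1"
  define hs where "hs = [\<lambda>x. f x + g x, \<lambda>x. f x + g x + 1, ?z, ?f, ?g,
    \<lambda>x. ?z x * ?f x, \<lambda>x. ?z x * ?f x + 1, \<lambda>x. ?z x * ?g x, \<lambda>x. ?z x * ?g x + 1,
    \<lambda>x. (?z x * ?f x + 1) * (?z x * ?g x + 1),
    \<lambda>x. ?z x * ?z x, \<lambda>x. ?f x * ?g x, \<lambda>x. ?f x * ?g x + 1, \<lambda>x. ?z x * ?z x * (?f x * ?g x + 1)]"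
  have len: "length hs = 14" by (simp add: hs_def)
  have "definable p (n + length hs) (set hs \<union> A)"
  proof (rule definable_extend[OF A fg])
    show "\<forall>h\<in>set hs. determined p h"
      unfolding determined_def
    proof (intro ballI allI impI)
      fix h and x y :: "nat \<Rightarrow> nat"
      assume h: "h \<in> set hs" and "\<forall>j\<in>{1..p}. x j = y j"
      then have "f x = f y" "g x = g y"
        using fg[THEN definable_determined[OF A]] unfolding determined_def by blast+
      with h show "h x = h y"
        unfolding hs_def by (auto simp only: list.set insert_iff empty_iff)
    qed
    fix m i j :: nat
    assume ij: "i \<in> {1..m}" "j \<in> {1..m}"
    let ?E = "{SuccEq (m+1) (m+2), SuccEq (m+2) (m+3), SuccEq i (m+4), SuccEq j (m+5),
      MultEq (m+3) (m+4) (m+6), SuccEq (m+6) (m+7), MultEq (m+3) (m+5) (m+8), SuccEq (m+8) (m+9),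
      MultEq (m+7) (m+9) (m+10), MultEq (m+3) (m+3) (m+11), MultEq (m+4) (m+5) (m+12),
      SuccEq (m+12) (m+13), MultEq (m+11) (m+13) (m+14), SuccEq (m+14) (m+10)}"
    have "(\<forall>e\<in>?E. satisfies y e) = (\<forall>t<length hs. y (m + Suc t) = (hs ! t) y)"
      if y: "y i = f y" "y j = g y" for y
    proof -
      have new: "(\<forall>t<length hs. y (m + Suc t) = (hs ! t) y) \<longleftrightarrow>
          y (m+1) = f y + g y \<and> y (m+2) = f y + g y + 1 \<and> y (m+3) = ?z y \<and> y (m+4) = ?f y \<and>
          y (m+5) = ?g y \<and> y (m+6) = ?z y * ?f y \<and> y (m+7) = ?z y * ?f y + 1 \<and>
          y (m+8) = ?z y * ?g y \<and> y (m+9) = ?z y * ?g y + 1 \<and>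
          y (m+10) = (?z y * ?f y + 1) * (?z y * ?g y + 1) \<and>
          y (m+11) = ?z y * ?z y \<and> y (m+12) = ?f y * ?g y \<and> y (m+13) = ?f y * ?g y + 1 \<and>
          y (m+14) = ?z y * ?z y * (?f y * ?g y + 1)"
        unfolding len by (simp only: eval_nat_numeral All_less_Suc2 hs_def nth_Cons_0 nth_Cons_Suc 
            not_less0 simp_thms One_nat_def BitM.simps)
      show ?thesis
      proof
        assume sat: "\<forall>e\<in>?E. satisfies y e"
        \<comment> \<open>All other new variables are functions of \<open>w\<close>, and the last equation then pins \<open>w\<close> down.\<close>
        let ?w = "y (m+1)"
        have eqs: "y (m+3) = ?w + 2" "y (m+4) = ?f y" "y (m+5) = ?g y"
            "y (m+6) = (?w+2) * ?f y" "y (m+8) = (?w+2) * ?g y"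
            "y (m+7) = (?w+2) * ?f y + 1" "y (m+9) = (?w+2) * ?g y + 1"
            "y (m+10) = ((?w+2) * ?f y + 1) * ((?w+2) * ?g y + 1)"
            "y (m+11) = (?w+2) * (?w+2)" "y (m+12) = ?f y * ?g y" "y (m+13) = ?f y * ?g y + 1"
            "y (m+14) = (?w+2) * (?w+2) * (?f y * ?g y + 1)" "y (m+10) = y (m+14) + 1"
            "y (m+2) = ?w + 1"
          using sat y by simp_all
        then have "?w + 2 = ?f y + ?g y"
          using sum_iff_products[of "?w + 2" "?f y" "?g y"] by simp
        then have w: "?w = f y + g y" by simp
        show "\<forall>t<length hs. y (m + Suc t) = (hs ! t) y"
          unfolding new using eqs unfolding w by blast
      next
        assume "\<forall>t<length hs. y (m + Suc t) = (hs ! t) y"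
        note eqs = this[unfolded new]
        have "(?z y * ?f y + 1) * (?z y * ?g y + 1) = ?z y * ?z y * (?f y * ?g y + 1) + 1"
          using sum_iff_products[of "?z y" "?f y" "?g y"] by simp
        with eqs y show "\<forall>e\<in>?E. satisfies y e" by simp
      qed
    qed
    moreover have "?E \<subseteq> G (m + length hs)"
      unfolding len G_def using ij by auto
    ultimately show "\<exists>E\<subseteq>G (m + length hs). \<forall>y. y i = f y \<longrightarrow> y j = g y \<longrightarrow>
        (\<forall>e\<in>E. satisfies y e) = (\<forall>t<length hs. y (m + Suc t) = (hs ! t) y)"
      by blast
  qed
  then show ?thesis
    by (rule definable_mono) (auto simp: len hs_def)
qed


section \<open>Polynomials with natural coefficients\<close>

lemma definable_mult_power:
  assumes A: "definable p n A" and fg: "f \<in> A" "g \<in> A"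
  shows "definable p (n + k) (insert (\<lambda>x. f x * g x ^ k) A)"
proof (induction k)
  case 0
  then show ?case using A fg by (simp add: insert_absorb)
next
  case (Suc k)
  show ?case
    by (rule definable_mono[OF definable_mult[OF Suc, of "\<lambda>x. f x * g x ^ k" g]])
      (use fg in \<open>auto simp: mult_ac\<close>)
qed

text \<open>
  Adding \<open>g\<close> one copy at a time makes the cost linear in the coefficient \<open>k\<close>, which is good enough
  because coefficients are bounded by the code of the equation.
\<close>

lemma definable_add_multiple:
  assumes A: "definable p n A" and fg: "f \<in> A" "g \<in> A"
  shows "definable p (n + 14 * k) (insert (\<lambda>x. f x + k * g x) A)"
proof (induction k)
  case 0
  then show ?case using A fg by (simp add: insert_absorb)
next
  case (Suc k)
  show ?case
    by (rule definable_mono[OF definable_add[OF Suc, of "\<lambda>x. f x + k * g x" g]])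
      (use fg in \<open>auto simp: add_ac\<close>)
qed

lemma definable_monomial:
  assumes "finite K" and A: "definable p n A" and one: "(\<lambda>x. 1) \<in> A"
    and proj: "\<And>i. i \<in> K \<Longrightarrow> (\<lambda>x. x i) \<in> A"
  shows "definable p (n + (\<Sum>i\<in>K. e i)) (insert (\<lambda>x. \<Prod>i\<in>K. x i ^ e i) A)"
  using assms(1) proj
proof (induction K rule: finite_induct)
  case empty
  then show ?case using A one by (simp add: insert_absorb)
next
  case (insert i K)
  have "definable p (n + (\<Sum>i\<in>K. e i)) (insert (\<lambda>x. \<Prod>i\<in>K. x i ^ e i) A)"
    using insert by simp
  from definable_mult_power[OF this, of "\<lambda>x. \<Prod>i\<in>K. x i ^ e i" "\<lambda>x. x i" "e i"]
  have "definable p (n + (\<Sum>i\<in>K. e i) + e i)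
      (Set.insert (\<lambda>x. (\<Prod>i\<in>K. x i ^ e i) * x i ^ e i) (Set.insert (\<lambda>x. \<Prod>i\<in>K. x i ^ e i) A))"
    using insert.prems by simp
  then show ?case
    by (rule definable_mono) (use insert.hyps in \<open>auto simp: mult_ac\<close>)
qed

lemma definable_polynomial:
  assumes "finite L" and A: "definable p n A" and zero: "(\<lambda>x. 0) \<in> A" and one: "(\<lambda>x. 1) \<in> A"
    and proj: "\<And>i. i \<in> {1..p} \<Longrightarrow> (\<lambda>x. x i) \<in> A"
    and L: "\<And>m. m \<in> L \<Longrightarrow> Poly_Mapping.keys m \<subseteq> {1..p} \<and> a m \<le> d \<and>
      (\<forall>i\<in>{1..p}. Poly_Mapping.lookup m i \<le> d)"
  shows "definable p (n + card L * (p * d + 14 * d))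
    (insert (\<lambda>x. \<Sum>m\<in>L. a m * (\<Prod>i\<in>Poly_Mapping.keys m. x i ^ Poly_Mapping.lookup m i)) A)"
  using assms(1) L
proof (induction L rule: finite_induct)
  case empty
  then show ?case using A zero by (simp add: insert_absorb)
next
  case (insert m L)
  let ?s = "\<lambda>x. \<Sum>m\<in>L. a m * (\<Prod>i\<in>Poly_Mapping.keys m. x i ^ Poly_Mapping.lookup m i)"
  let ?m = "\<lambda>x. \<Prod>i\<in>Poly_Mapping.keys m. x i ^ Poly_Mapping.lookup m i"
  let ?n = "n + card L * (p * d + 14 * d)"
  have m: "Poly_Mapping.keys m \<subseteq> {1..p}" "a m \<le> d" "\<And>i. i \<in> {1..p} \<Longrightarrow> Poly_Mapping.lookup m i \<le> d"
    using insert.prems by auto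
  have "definable p ?n (Set.insert ?s A)"
    using insert by simp
  then have "definable p (?n + (\<Sum>i\<in>Poly_Mapping.keys m. Poly_Mapping.lookup m i))
      (Set.insert ?m (Set.insert ?s A))"
    by (intro definable_monomial) (use m one proj in auto)
  from definable_add_multiple[OF this, of ?s ?m "a m"]
  have "definable p (?n + (\<Sum>i\<in>Poly_Mapping.keys m. Poly_Mapping.lookup m i) + 14 * a m)
      (Set.insert (\<lambda>x. ?s x + a m * ?m x) (Set.insert ?m (Set.insert ?s A)))"
    by simp
  then show ?case
  proof (rule definable_mono)
    have "(\<Sum>i\<in>Poly_Mapping.keys m. Poly_Mapping.lookup m i) \<le> card (Poly_Mapping.keys m) * d"
      using sum_bounded_above[of "Poly_Mapping.keys m" "Poly_Mapping.lookup m" d]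
        m(3)[OF subsetD[OF m(1)]] by simp
    also have "\<dots> \<le> p * d"
      using card_mono[OF _ m(1)] by simp
    finally show "?n + (\<Sum>i\<in>Poly_Mapping.keys m. Poly_Mapping.lookup m i) + 14 * a m
        \<le> n + card (Set.insert m L) * (p * d + 14 * d)"
      using m(2) insert.hyps by simp
  qed (use insert.hyps in \<open>auto simp: add_ac\<close>)
qed


section \<open>A Diophantine equation as a system\<close>

text \<open>
  The parts with positive and with negative coefficients: truncation by \<open>nat\<close> makes the coefficient
  of a monomial vanish in one of the two sums, so both can range over all monomials.
\<close>

lemma mpoly_eval_int:
  "mpoly_eval D (\<lambda>i. int (x i)) =
     int (\<Sum>m\<in>Poly_Mapping.keys D. nat (Poly_Mapping.lookup D m) *
        (\<Prod>i\<in>Poly_Mapping.keys m. x i ^ Poly_Mapping.lookup m i)) -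
     int (\<Sum>m\<in>Poly_Mapping.keys D. nat (- Poly_Mapping.lookup D m) *
        (\<Prod>i\<in>Poly_Mapping.keys m. x i ^ Poly_Mapping.lookup m i))"
proof -
  have "c * int M = int (nat c * M) - int (nat (- c) * M)" for c M
    by (cases "c \<ge> 0") auto
  then show ?thesis
    unfolding mpoly_eval_def of_nat_sum sum_subtractf[symmetric] of_nat_power[symmetric]
      of_nat_prod[symmetric] by presburger
qed

text \<open>
  The systems for \<open>P\<close> and \<open>N\<close> impose nothing on \<open>x\<^sub>1,\<dots>,x\<^sub>p\<close>; the equation \<open>D = 0\<close> enters as one more
  equation \<open>P * 1 = N\<close> between their coordinates.
\<close>

lemma dioph_system:
  assumes p: "p \<ge> 1" and D: "D \<in> int_mpolys p"
    and coeffs: "\<And>m. m \<in> Poly_Mapping.keys D \<Longrightarrow> \<bar>Poly_Mapping.lookup D m\<bar> \<le> int d"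
    and exps: "\<And>m i. m \<in> Poly_Mapping.keys D \<Longrightarrow> i \<in> {1..p} \<Longrightarrow> Poly_Mapping.lookup m i \<le> d"
  obtains n S where "p \<le> n" "n \<le> p + 2 + 2 * (card (Poly_Mapping.keys D) * (p * d + 14 * d))"
    "S \<subseteq> G n"
    "bij_betw (\<lambda>y. restrict y {1..p}) (system_solutions n S) (dioph_solutions p D)"
proof -
  let ?L = "Poly_Mapping.keys D"
  let ?P = "\<lambda>x. \<Sum>m\<in>?L. nat (Poly_Mapping.lookup D m) *
        (\<Prod>i\<in>Poly_Mapping.keys m. x i ^ Poly_Mapping.lookup m i)"
  let ?N = "\<lambda>x. \<Sum>m\<in>?L. nat (- Poly_Mapping.lookup D m) *
        (\<Prod>i\<in>Poly_Mapping.keys m. x i ^ Poly_Mapping.lookup m i)"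
  let ?k = "card ?L * (p * d + 14 * d)"
  define A :: "((nat \<Rightarrow> nat) \<Rightarrow> nat) set"
    where "A = {\<lambda>x. 0, \<lambda>x. 1} \<union> (\<lambda>i x. x i) ` {1..p}"
  have A: "definable p (p + 2) A"
    unfolding A_def using p by (intro definable_zero_one[OF definable_projections]) auto
  have "definable p (p + 2 + ?k) (insert ?P A)"
    by (rule definable_polynomial[OF _ A])
      (use D coeffs exps in \<open>fastforce simp: A_def int_mpolys_def\<close>)+
  then have "definable p (p + 2 + ?k + ?k) (insert ?N (insert ?P A))"
    by (rule definable_polynomial[rotated])
      (use D coeffs exps in \<open>fastforce simp: A_def int_mpolys_def\<close>)+
  then obtain n F S where n: "n \<le> p + 2 + 2 * ?k" and A_F: "insert ?N (insert ?P A) \<subseteq> F ` {1..n}"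
    and F: "S \<subseteq> G n" "p \<le> n" "\<forall>i\<in>{1..p}. F i = (\<lambda>x. x i)" "\<forall>i\<in>{1..n}. determined p (F i)"
      "\<forall>y. (\<forall>e\<in>S. satisfies y e) \<longleftrightarrow> (\<forall>i\<in>{1..n}. y i = F i y)"
    unfolding definable_def forces_def mult_2 add.assoc by blast
  obtain a b c where abc: "a \<in> {1..n}" "b \<in> {1..n}" "c \<in> {1..n}"
      "F a = ?P" "F b = ?N" "F c = (\<lambda>x. 1)"
    using A_F unfolding A_def by (smt (verit) UnCI imageE insertCI subsetD)
  let ?S = "insert (MultEq a c b) S"
  have sat: "(\<forall>e\<in>?S. satisfies y e) \<longleftrightarrow>
      (\<forall>i\<in>{1..n}. y i = F i y) \<and> mpoly_eval D (\<lambda>i. int (y i)) = 0" for y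
  proof -
    have "satisfies y (MultEq a c b) \<longleftrightarrow> ?P y = ?N y" if "\<forall>i\<in>{1..n}. y i = F i y"
    proof -
      have "y a = ?P y" "y b = ?N y" "y c = 1" using that abc by metis+
      then show ?thesis by simp
    qed
    moreover have "mpoly_eval D (\<lambda>i. int (y i)) = 0 \<longleftrightarrow> ?P y = ?N y"
      unfolding mpoly_eval_int by linarith
    ultimately show ?thesis using F(5) by auto
  qed
  have eval_cong: "mpoly_eval D (\<lambda>i. int (x i)) = mpoly_eval D (\<lambda>i. int (y i))"
    if "\<forall>i\<in>{1..p}. x i = y i" for x y
    unfolding mpoly_eval_def
    by (intro sum.cong prod.cong arg_cong2[where f = times] refl)
      (use D that in \<open>auto simp: int_mpolys_def subset_iff\<close>)
  have "bij_betw (\<lambda>y. restrict y {1..p}) (system_solutions n ?S) (dioph_solutions p D)"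
  proof (rule bij_betw_byWitness[where f' = "\<lambda>x. \<lambda>i\<in>{1..n}. F i x"])
    have det: "F i (restrict y {1..p}) = F i y" if "i \<in> {1..n}" for i y
      using F(4) that unfolding determined_def by simp
    have old: "(\<lambda>i\<in>{1..n}. F i x) j = x j" if "j \<in> {1..p}" for x j
      using F(2,3) that by auto
    have det': "F i (\<lambda>i\<in>{1..n}. F i x) = F i x" if "i \<in> {1..n}" for i x
      using F(4) that old unfolding determined_def by blast
    show "\<forall>y\<in>system_solutions n ?S. (\<lambda>i\<in>{1..n}. F i (restrict y {1..p})) = y"
    proof
      fix y assume "y \<in> system_solutions n ?S"
      then have y: "y \<in> {1..n} \<rightarrow>\<^sub>E UNIV" "\<forall>i\<in>{1..n}. y i = F i y"
        using sat unfolding system_solutions_def by blast+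
      show "(\<lambda>i\<in>{1..n}. F i (restrict y {1..p})) = y"
        by (rule ext) (use y det in \<open>auto simp: PiE_def extensional_def\<close>)
    qed
    show "\<forall>x\<in>dioph_solutions p D. restrict (\<lambda>i\<in>{1..n}. F i x) {1..p} = x"
    proof
      fix x assume "x \<in> dioph_solutions p D"
      then have "x \<in> extensional {1..p}" unfolding dioph_solutions_def PiE_def by blast
      then show "restrict (\<lambda>i\<in>{1..n}. F i x) {1..p} = x"
        using old by (intro extensionalityI[of _ "{1..p}"]) auto
    qed
    show "(\<lambda>y. restrict y {1..p}) ` system_solutions n ?S \<subseteq> dioph_solutions p D"
    proof (rule image_subsetI)
      fix y assume "y \<in> system_solutions n ?S"
      then have "mpoly_eval D (\<lambda>i. int (y i)) = 0"
        using sat unfolding system_solutions_def by blast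
      then show "restrict y {1..p} \<in> dioph_solutions p D"
        using eval_cong[of "restrict y {1..p}" y] unfolding dioph_solutions_def by simp
    qed
    show "(\<lambda>x. \<lambda>i\<in>{1..n}. F i x) ` dioph_solutions p D \<subseteq> system_solutions n ?S"
    proof (rule image_subsetI)
      fix x assume "x \<in> dioph_solutions p D"
      then have "mpoly_eval D (\<lambda>i. int (x i)) = 0" unfolding dioph_solutions_def by simp
      then have "mpoly_eval D (\<lambda>i. int ((\<lambda>i\<in>{1..n}. F i x) i)) = 0"
        using eval_cong[of "\<lambda>i\<in>{1..n}. F i x" x] old by simp
      then have "\<forall>e\<in>?S. satisfies (\<lambda>i\<in>{1..n}. F i x) e"
        unfolding sat using det' by simp
      then show "(\<lambda>i\<in>{1..n}. F i x) \<in> system_solutions n ?S"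
        unfolding system_solutions_def by simp
    qed
  qed
  moreover have "?S \<subseteq> G n" using F(1) abc unfolding G_def by blast
  ultimately show thesis using that F(2) n by blast
qed


section \<open>The code of an equation bounds its size\<close>

lemma le_list_encode: "x \<in> set xs \<Longrightarrow> x \<le> list_encode xs"
proof (induction xs)
  case (Cons y ys)
  then show ?case
    using le_prod_encode_1[of y "list_encode ys"] le_prod_encode_2[of "list_encode ys" y] by fastforce
qed simp

lemma abs_le_int_encode: "\<bar>k\<bar> \<le> int (int_encode k)"
  by (simp add: int_encode_def sum_encode_def)

lemma le_set_encode: "finite X \<Longrightarrow> x \<in> X \<Longrightarrow> x \<le> set_encode X"
proof -
  assume "finite X" "x \<in> X"
  then have "2 ^ x \<le> set_encode X"
    unfolding set_encode_def by (intro member_le_sum) auto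
  then show ?thesis using less_exp[of x] by linarith
qed

lemma card_le_set_encode: "card X \<le> set_encode X"
proof -
  have "(\<Sum>x\<in>X. 1) \<le> (\<Sum>x\<in>X. 2 ^ x :: nat)" by (rule sum_mono) simp
  then show ?thesis by (simp add: set_encode_def)
qed

text \<open>
  Pairing and list coding dominate their components, and a set code \<open>\<Sum>x\<in>X. 2 ^ x\<close> dominates both
  the elements and the cardinality of \<open>X\<close>.
\<close>

lemma dioph_code_bounds:
  fixes D :: int_mpoly and p :: nat
  defines "c \<equiv> dioph_code p D"
  assumes D: "D \<in> int_mpolys p"
  shows "p \<le> c" "card (Poly_Mapping.keys D) \<le> c"
    and "m \<in> Poly_Mapping.keys D \<Longrightarrow> \<bar>Poly_Mapping.lookup D m\<bar> \<le> int c"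
    and "m \<in> Poly_Mapping.keys D \<Longrightarrow> i \<in> {1..p} \<Longrightarrow> Poly_Mapping.lookup m i \<le> c"
proof -
  let ?v = "\<lambda>m. list_encode (map (Poly_Mapping.lookup m) [1..<Suc p])"
  let ?t = "\<lambda>m. prod_encode (?v m, int_encode (Poly_Mapping.lookup D m))"
  let ?X = "?t ` Poly_Mapping.keys D"
  have c: "c = prod_encode (p, set_encode ?X)" unfolding c_def dioph_code_def ..
  then show "p \<le> c" by (simp add: le_prod_encode_1)
  have X: "set_encode ?X \<le> c" unfolding c by (rule le_prod_encode_2)
  have "inj_on ?t (Poly_Mapping.keys D)"
  proof (rule inj_onI)
    fix m m' assume "m \<in> Poly_Mapping.keys D" "m' \<in> Poly_Mapping.keys D" "?t m = ?t m'"
    then show "m = m'"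
      using D unfolding prod_encode_eq prod.inject list_encode_eq int_mpolys_def
      by (intro exponent_vector_inj[of m p m']) auto
  qed
  then have "card (Poly_Mapping.keys D) = card ?X" by (rule card_image[symmetric])
  also note card_le_set_encode
  also note X
  finally show "card (Poly_Mapping.keys D) \<le> c" .
  assume m: "m \<in> Poly_Mapping.keys D"
  then have t: "?t m \<le> c"
    using le_set_encode[of ?X "?t m"] X by simp
  have "int_encode (Poly_Mapping.lookup D m) \<le> c"
    using le_prod_encode_2 t by (rule order_trans)
  then show "\<bar>Poly_Mapping.lookup D m\<bar> \<le> int c"
    using abs_le_int_encode[of "Poly_Mapping.lookup D m"] by linarith
  have v: "?v m \<le> c"
    using le_prod_encode_1 t by (rule order_trans)
  assume "i \<in> {1..p}"
  then have "Poly_Mapping.lookup m i \<in> set (map (Poly_Mapping.lookup m) [1..<Suc p])"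
    unfolding set_map set_upt by (intro imageI) simp
  from le_list_encode[OF this] v show "Poly_Mapping.lookup m i \<le> c" by (rule order_trans)
qed

text \<open>
  The exponent \<open>4 * (c + 2)\<close> is nested in the form in which it is computed, by two doublings. The
  successor matches \<open>recursive_bound_f\<close>: the iteration that defines \<open>bound_f\<close> starts at argument 1.
\<close>

lemma size_le_power:
  fixes c p k n :: nat
  assumes "p \<le> c" "k \<le> c" and n: "n \<le> p + 2 + 2 * (k * (p * c + 14 * c))"
  shows "2 * n \<le> Suc (2 ^ (2 * (2 * (c + 2))))"
proof -
  define q :: nat where "q = 2 ^ c"
  have c: "c \<le> q" unfolding q_def by (rule less_imp_le[OF less_exp])
  have q: "1 \<le> q" unfolding q_def by simp
  have "k * (p * c + 14 * c) \<le> q * (q * q + 14 * q)"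
    using assms(1,2) c by (intro mult_mono add_mono) auto
  with n assms(1) c have "2 * n \<le> 2 * q + 4 + 4 * (q * (q * q + 14 * q))" by linarith
  also have "\<dots> \<le> 256 * q ^ 4"
  proof -
    have "q ^ 1 \<le> q ^ 4" "q ^ 2 \<le> q ^ 4" "q ^ 3 \<le> q ^ 4"
      using q by (intro power_increasing; simp)+
    moreover have "1 \<le> q ^ 4" using q by (rule one_le_power)
    ultimately show ?thesis by (simp add: algebra_simps power2_eq_square power3_eq_cube)
  qed
  also have "\<dots> = 2 ^ (2 * (2 * (c + 2)))"
    unfolding q_def by (simp add: power_add power_mult[symmetric] mult.commute)
  finally show ?thesis by simp
qed

theorem theorem1:
  assumes "conjecture_A"
  shows "\<exists>r. \<forall>p \<ge> 1. \<forall>D \<in> int_mpolys p. \<exists>b :: int.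
           rec_eval r [dioph_code p D] (int_encode b) \<and>
           (finite (dioph_solutions p D) \<longrightarrow>
              (\<forall>x \<in> dioph_solutions p D. \<forall>i \<in> {1..p}. int (x i) \<le> b))"
proof -
  \<comment> \<open>The factor 2 below accounts for \<open>int_encode\<close>, which sends a natural number \<open>b\<close> to \<open>2 * b\<close>.\<close>
  define B where "B c = bound_f (Suc (2 ^ (2 * (2 * (c + 2)))))" for c
  have "recursive (\<lambda>c. 2 * B c)"
  proof -
    have "recursive (\<lambda>c. 2 * (2 * Suc (Suc c)))"
      using recursive_comp[OF recursive_double recursive_comp[OF recursive_double
            recursive_comp[OF recursive_Suc recursive_Suc]]] .
    from recursive_comp[OF recursive_double recursive_comp[OF recursive_bound_f
          recursive_comp[OF recursive_power2 this]]]
    show ?thesis by (simp add: B_def)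
  qed
  then obtain r where r: "\<And>c. rec_eval r [c] (2 * B c)" unfolding recursive_def by blast
  show ?thesis
  proof (intro exI[of _ r] allI impI ballI)
    fix p D assume p: "1 \<le> p" and D: "D \<in> int_mpolys p"
    let ?c = "dioph_code p D"
    note bounds = dioph_code_bounds[OF D]
    obtain n S where n: "p \<le> n" "n \<le> p + 2 + 2 * (card (Poly_Mapping.keys D) * (p * ?c + 14 * ?c))"
      and S: "S \<subseteq> G n"
      and bij: "bij_betw (\<lambda>y. restrict y {1..p}) (system_solutions n S) (dioph_solutions p D)"
      using dioph_system[OF p D bounds(3,4)] by blast
    have "x i \<le> B ?c" if fin: "finite (dioph_solutions p D)" and x: "x \<in> dioph_solutions p D"
      and i: "i \<in> {1..p}" for x i
    proof -
      have "finite (system_solutions n S)" using bij_betw_finite[OF bij] fin by simp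
      moreover obtain y where y: "y \<in> system_solutions n S" "x = restrict y {1..p}"
        using x bij_betw_imp_surj_on[OF bij] by blast
      ultimately have "y i \<le> bound_f (2 * n)"
        using assms p n(1) S i unfolding conjecture_A_def by auto
      also have "\<dots> \<le> B ?c"
        unfolding B_def by (intro bound_f_mono size_le_power[OF bounds(1,2) n(2)])
      finally show ?thesis using y(2) i by simp
    qed
    moreover have "int_encode (int (B ?c)) = 2 * B ?c"
      by (simp add: int_encode_def sum_encode_def)
    ultimately show "\<exists>b. rec_eval r [?c] (int_encode b) \<and> (finite (dioph_solutions p D) \<longrightarrow>
        (\<forall>x \<in> dioph_solutions p D. \<forall>i \<in> {1..p}. int (x i) \<le> b))"
      using r[of ?c] by (intro exI[of _ "int (B ?c)"]) simp
  qed
qed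

end
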